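(* Let $A\in\mathbb{R}^{n\times m}$ have rank $r$ and thin SVD $A=U\Sigma V^\top$, and let $u_i,v_j\in\mathbb{R}^r$ be the $i$th row of $U$ and the $j$th row of $V$. Suppose $A_{\widehat i,\widehat j}\ne0$ and let $$E^{(\widehat i,\widehat j)}=A-A(:,\widehat j)\,A_{\widehat i,\widehat j}^{-1}\,A(\widehat i,:).$$ Let $\varepsilon_u,\varepsilon_v\in[0,1]$, let $\ell\in\{1,\ldots,n\}$, $p\in\{1,\ldots,m\}$ be such that the weighted angles below are defined, and suppose $$\cos\angle_\sigma(u_\ell,u_{\widehat i})\ge1-\varepsilon_u,\qquad\cos\angle_\sigma(v_p,v_{\widehat j})\ge1-\varepsilon_v.$$ Then $$\left|E^{(\widehat i,\widehat j)}_{\ell p}\right|\le\frac{\|u_\ell\|_\sigma\|v_p\|_\sigma\sqrt{(2\varepsilon_u-\varepsilon_u^2)(2\varepsilon_v-\varepsilon_v^2)}}{\left|\cos\angle_\sigma(u_{\widehat i},v_{\widehat j})\right|}.$$ In particular, if $\varepsilon_u=\varepsilon_v=\varepsilon$, then $$\left|E^{(\widehat i,\widehat j)}_{\ell p}\right|\le\frac{(2\varepsilon-\varepsilon^2)\|u_\ell\|_\sigma\|v_p\|_\sigma}{\left|\cos\angle_\sigma(u_{\widehat i},v_{\widehat j})\right|}\le\frac{2\varepsilon\|u_\ell\|_\sigma\|v_p\|_\sigma}{\left|\cos\angle_\sigma(u_{\widehat i},v_{\widehat j})\right|}.$$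
   Context: Thin SVD: $U\in\mathbb{R}^{n\times r}$, $V\in\mathbb{R}^{m\times r}$ have orthonormal columns, $\Sigma=\operatorname{diag}(\sigma_1,\ldots,\sigma_r)$ with $\sigma_1\ge\cdots\ge\sigma_r>0$. For $x,y\in\mathbb{R}^r$, $\langle x,y\rangle_\sigma=x^\top\Sigma y$ and $\|x\|_\sigma=\sqrt{\langle x,x\rangle_\sigma}$. When $\|x\|_\sigma,\|y\|_\sigma\neq0$, the weighted angle $\angle_\sigma(x,y)\in[0,\pi]$ is defined by $\cos\angle_\sigma(x,y)=\langle x,y\rangle_\sigma/(\|x\|_\sigma\|y\|_\sigma)$. $A(:,\widehat j)$ and $A(\widehat i,:)$ are the $\widehat j$th column and the $\widehat i$th row of $A$. *)

theory Defs
  imports "HOL-Analysis.Analysis"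
begin

text \<open>
  An \<open>n \<times> m\<close> real matrix has type \<^typ>\<open>real^'m^'n\<close>, the row index being the outer one.
  The rank \<open>r\<close> is the cardinality of a finite linearly ordered index type \<open>'r\<close>; the order
  is needed to say that the singular values decrease. Index types are nonempty, so \<open>r = 0\<close>
  is excluded; a matrix with a nonzero entry has positive rank anyway.
\<close>

definition diag_matrix :: "real^'r \<Rightarrow> real^'r^'r" where
  "diag_matrix s = (\<chi> k l. if k = l then s $ k else 0)"

definition orthonormal_columns :: "real^'r^'n \<Rightarrow> bool" where
  "orthonormal_columns Q \<longleftrightarrow>
     (\<forall>k l. column k Q \<bullet> column l Q = (if k = l then 1 else 0))"

definition thin_svd ::
  "real^'m^'n \<Rightarrow> real^('r::{finite,linorder})^'n \<Rightarrow> real^('r::{finite,linorder})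
     \<Rightarrow> real^('r::{finite,linorder})^'m \<Rightarrow> bool" where
  "thin_svd A U s V \<longleftrightarrow>
     orthonormal_columns U \<and> orthonormal_columns V \<and>
     (\<forall>k l. k \<le> l \<longrightarrow> s $ l \<le> s $ k) \<and> (\<forall>k. 0 < s $ k) \<and>
     A = U ** diag_matrix s ** transpose V"

definition weighted_inner :: "real^'r \<Rightarrow> real^'r \<Rightarrow> real^'r \<Rightarrow> real" where
  "weighted_inner s x y = x \<bullet> (diag_matrix s *v y)"

definition weighted_norm :: "real^'r \<Rightarrow> real^'r \<Rightarrow> real" where
  "weighted_norm s x = sqrt (weighted_inner s x x)"

text \<open>
  \<^const>\<open>arccos\<close> picks the unique angle in \<open>[0, \<pi>]\<close> with the given cosine. The weighted angle
  is meaningful only if \<open>s\<close> is positive and both weighted norms are nonzero.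
\<close>

definition weighted_angle :: "real^'r \<Rightarrow> real^'r \<Rightarrow> real^'r \<Rightarrow> real" where
  "weighted_angle s x y =
     arccos (weighted_inner s x y / (weighted_norm s x * weighted_norm s y))"

definition cross_residual :: "real^'m^'n \<Rightarrow> 'n \<Rightarrow> 'm \<Rightarrow> real^'m^'n" where
  "cross_residual A i j =
     A - inverse (A $ i $ j) *\<^sub>R ((columnvector (column j A) :: real^1^'n) ** rowvector (row i A))"

end

theory Submission
  imports Defs
begin

text \<open>
  Scaling every coordinate by the square root of its weight turns the weighted inner product into
  the ordinary one (\<open>weighted_inner_eq_inner_sqrt_scale\<close>), so let \<open>x\<close>, \<open>y\<close>, \<open>z\<close>, \<open>w\<close> be the scaled
  rows \<open>u\<^sub>l\<close>, \<open>u\<^sub>i\<close>, \<open>v\<^sub>p\<close>, \<open>v\<^sub>j\<close>. The entries of \<open>A\<close> are the inner products of scaled rows of \<open>U\<close> and \<open>V\<close>,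
  and the residual entry is a quotient of a \<open>2 \<times> 2\<close> minor by the pivot:
  \<open>E\<^sub>l\<^sub>p = ((x \<bullet> z) (y \<bullet> w) - (x \<bullet> w) (y \<bullet> z)) / (y \<bullet> w)\<close>.
  The numerator is the inner product of the bivectors \<open>x \<and> y\<close> and \<open>z \<and> w\<close> (the Binet-Cauchy
  identity), so Cauchy-Schwarz bounds it by the product of the areas of the two parallelograms
  (\<open>binet_cauchy_bound\<close>). Such an area is \<open>\<parallel>x\<parallel> \<parallel>y\<parallel> sin \<theta>\<close>, and \<open>cos \<theta> \<ge> 1 - \<epsilon>\<close> gives
  \<open>sin\<^sup>2 \<theta> \<le> 2 \<epsilon> - \<epsilon>\<^sup>2\<close> (\<open>gram_le_of_cos_ge\<close>). Since the pivot is \<open>\<parallel>y\<parallel> \<parallel>w\<parallel> cos \<angle>(y, w)\<close>, the norms of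
  \<open>y\<close> and \<open>w\<close> cancel.
\<close>

text \<open>
  The coordinate matrix of the bivector \<open>x \<and> y\<close>. Every coordinate with \<open>k \<noteq> l\<close> occurs twice, with
  opposite signs, so inner products of these matrices are twice those of the bivectors.
\<close>

definition wedge :: "real^'r \<Rightarrow> real^'r \<Rightarrow> real^'r^'r" where
  "wedge x y = (\<chi> k l. x $ k * y $ l - x $ l * y $ k)"

lemma inner_wedge:
  fixes x y z w :: "real^'r"
  shows "wedge x y \<bullet> wedge z w = 2 * ((x \<bullet> z) * (y \<bullet> w) - (x \<bullet> w) * (y \<bullet> z))"
proof -
  have prod: "(a \<bullet> b) * (c \<bullet> d) = (\<Sum>k\<in>UNIV. \<Sum>l\<in>UNIV. (a $ k * b $ k) * (c $ l * d $ l))"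
    for a b c d :: "real^'r"
    by (simp add: inner_vec_def sum_product)
  have "wedge x y \<bullet> wedge z w =
      (\<Sum>k\<in>UNIV. \<Sum>l\<in>UNIV. (x $ k * z $ k) * (y $ l * w $ l) + (y $ k * w $ k) * (x $ l * z $ l)
        - (x $ k * w $ k) * (y $ l * z $ l) - (y $ k * z $ k) * (x $ l * w $ l))"
    by (simp add: wedge_def inner_vec_def algebra_simps)
  also have "\<dots> = (x \<bullet> z) * (y \<bullet> w) + (y \<bullet> w) * (x \<bullet> z) - (x \<bullet> w) * (y \<bullet> z) - (y \<bullet> z) * (x \<bullet> w)"
    by (simp only: sum.distrib sum_subtractf prod)
  finally show ?thesis
    by (simp add: algebra_simps)
qed

lemma binet_cauchy_bound:
  fixes x y z w :: "real^'r"
  shows "((x \<bullet> z) * (y \<bullet> w) - (x \<bullet> w) * (y \<bullet> z))\<^sup>2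
    \<le> ((x \<bullet> x) * (y \<bullet> y) - (x \<bullet> y)\<^sup>2) * ((z \<bullet> z) * (w \<bullet> w) - (z \<bullet> w)\<^sup>2)"
proof -
  have halve: "a\<^sup>2 \<le> b * c" if "(2 * a)\<^sup>2 \<le> (2 * b) * (2 * c)" for a b c :: real
    using that by (simp add: power2_eq_square)
  have "(2 * ((x \<bullet> z) * (y \<bullet> w) - (x \<bullet> w) * (y \<bullet> z)))\<^sup>2
      \<le> (2 * ((x \<bullet> x) * (y \<bullet> y) - (x \<bullet> y)\<^sup>2)) * (2 * ((z \<bullet> z) * (w \<bullet> w) - (z \<bullet> w)\<^sup>2))"
    using Cauchy_Schwarz_ineq[of "wedge x y" "wedge z w"]
    unfolding inner_wedge inner_commute[of y x] inner_commute[of w z] power2_eq_square .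
  then show ?thesis
    by (rule halve)
qed

lemma gram_le_of_cos_ge:
  fixes x y :: "'a::real_inner"
  assumes "x \<noteq> 0" "y \<noteq> 0" "\<epsilon> \<le> 1" "(x \<bullet> y) / (norm x * norm y) \<ge> 1 - \<epsilon>"
  shows "(x \<bullet> x) * (y \<bullet> y) - (x \<bullet> y)\<^sup>2 \<le> (norm x)\<^sup>2 * (norm y)\<^sup>2 * (2 * \<epsilon> - \<epsilon>\<^sup>2)"
proof -
  have "(1 - \<epsilon>) * (norm x * norm y) \<le> x \<bullet> y"
    using assms by (simp add: pos_le_divide_eq)
  \<comment> \<open>Squaring preserves the inequality because \<open>\<epsilon> \<le> 1\<close> makes the left side nonnegative.\<close>
  then have "((1 - \<epsilon>) * (norm x * norm y))\<^sup>2 \<le> (x \<bullet> y)\<^sup>2"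
    using assms by (intro power_mono) auto
  then show ?thesis
    by (simp add: dot_square_norm power2_eq_square algebra_simps)
qed

text \<open>
  The linear map that, for nonnegative weights, carries the weighted inner product to the ordinary
  one.
\<close>

definition sqrt_scale :: "real^'r \<Rightarrow> real^'r \<Rightarrow> real^'r" where
  "sqrt_scale s x = (\<chi> k. sqrt (s $ k) * x $ k)"

lemma diag_matrix_mult_vec: "diag_matrix s *v x = (\<chi> k. s $ k * x $ k)"
  by (simp add: diag_matrix_def matrix_vector_mult_def vec_eq_iff if_distrib[of "\<lambda>a. a * _"]
      cong: if_cong)

lemma weighted_inner_eq_inner_sqrt_scale:
  assumes "\<And>k. 0 \<le> s $ k"
  shows "weighted_inner s x y = sqrt_scale s x \<bullet> sqrt_scale s y"
proof -
  have "x $ k * (s $ k * y $ k) = (sqrt (s $ k) * x $ k) * (sqrt (s $ k) * y $ k)" for k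
  proof -
    have "s $ k = sqrt (s $ k) * sqrt (s $ k)"
      using assms by simp
    then show ?thesis
      by (metis mult.assoc mult.left_commute)
  qed
  then show ?thesis
    unfolding weighted_inner_def diag_matrix_mult_vec sqrt_scale_def inner_vec_def
    by (simp only: vec_lambda_beta inner_real_def)
qed

lemma weighted_norm_eq_norm_sqrt_scale:
  assumes "\<And>k. 0 \<le> s $ k"
  shows "weighted_norm s x = norm (sqrt_scale s x)"
  using assms
  by (simp add: weighted_norm_def weighted_inner_eq_inner_sqrt_scale norm_eq_sqrt_inner)

lemma cos_weighted_angle:
  assumes "\<And>k. 0 \<le> s $ k"
  shows "cos (weighted_angle s x y) = weighted_inner s x y / (weighted_norm s x * weighted_norm s y)"
proof -
  let ?x = "sqrt_scale s x" and ?y = "sqrt_scale s y"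
  have "\<bar>(?x \<bullet> ?y) / (norm ?x * norm ?y)\<bar> \<le> 1"
    using Cauchy_Schwarz_ineq2[of ?x ?y] by (auto simp: abs_mult divide_le_eq_1 zero_less_mult_iff)
  then show ?thesis
    unfolding weighted_angle_def weighted_inner_eq_inner_sqrt_scale[OF assms]
      weighted_norm_eq_norm_sqrt_scale[OF assms]
    by (intro cos_arccos_abs)
qed

lemma thin_svd_entry:
  assumes "thin_svd A U s V"
  shows "A $ a $ b = weighted_inner s (row a U) (row b V)"
proof -
  have "A = U ** (diag_matrix s ** transpose V)"
    using assms by (simp add: thin_svd_def matrix_mul_assoc)
  moreover have "(diag_matrix s ** transpose V) $ k $ b = s $ k * V $ b $ k" for k
    by (simp add: diag_matrix_def matrix_matrix_mult_def transpose_def if_distrib[of "\<lambda>a. a * _"]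
        cong: if_cong)
  ultimately show ?thesis
    by (simp add: weighted_inner_def diag_matrix_mult_vec inner_vec_def row_def
        matrix_matrix_mult_def[of U])
qed

lemma cross_residual_entry:
  "cross_residual A i j $ l $ p = A $ l $ p - A $ l $ j * A $ i $ p / A $ i $ j"
  by (simp add: cross_residual_def matrix_matrix_mult_def columnvector_def rowvector_def
      column_def row_def divide_inverse)

text \<open>
  The residual bound in unweighted form: \<open>y \<bullet> w\<close> is the pivot, and the left side is the absolute value
  of the corresponding Schur complement of the Gram matrix of \<open>x, y\<close> against \<open>z, w\<close>.
\<close>

lemma abs_minor_quotient_bound:
  fixes x y z w :: "real^'r"
  assumes "y \<bullet> w \<noteq> 0" "x \<noteq> 0" "z \<noteq> 0" "\<epsilon> \<in> {0..1}" "\<delta> \<in> {0..1}"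
    and cos_xy: "(x \<bullet> y) / (norm x * norm y) \<ge> 1 - \<epsilon>"
    and cos_zw: "(z \<bullet> w) / (norm z * norm w) \<ge> 1 - \<delta>"
  shows "\<bar>x \<bullet> z - (x \<bullet> w) * (y \<bullet> z) / (y \<bullet> w)\<bar>
    \<le> norm x * norm z * sqrt ((2 * \<epsilon> - \<epsilon>\<^sup>2) * (2 * \<delta> - \<delta>\<^sup>2)) / \<bar>(y \<bullet> w) / (norm y * norm w)\<bar>"
proof -
  have ne: "y \<noteq> 0" "w \<noteq> 0"
    using assms(1) by auto
  have nonneg: "0 \<le> 2 * a - a\<^sup>2" if "a \<in> {0..1}" for a :: real
  proof -
    have "0 \<le> a * (2 - a)"
      using that by simp
    then show ?thesis
      by (simp add: algebra_simps power2_eq_square)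
  qed
  define N where "N = (x \<bullet> z) * (y \<bullet> w) - (x \<bullet> w) * (y \<bullet> z)"
  have "N\<^sup>2 \<le> ((x \<bullet> x) * (y \<bullet> y) - (x \<bullet> y)\<^sup>2) * ((z \<bullet> z) * (w \<bullet> w) - (z \<bullet> w)\<^sup>2)"
    unfolding N_def by (rule binet_cauchy_bound)
  also have "\<dots> \<le> ((norm x)\<^sup>2 * (norm y)\<^sup>2 * (2 * \<epsilon> - \<epsilon>\<^sup>2)) * ((norm z)\<^sup>2 * (norm w)\<^sup>2 * (2 * \<delta> - \<delta>\<^sup>2))"
    using assms ne nonneg Cauchy_Schwarz_ineq[of z w]
    by (intro mult_mono gram_le_of_cos_ge) auto
  also have "\<dots> = (norm x * norm y * norm z * norm w)\<^sup>2 * ((2 * \<epsilon> - \<epsilon>\<^sup>2) * (2 * \<delta> - \<delta>\<^sup>2))"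
    by (simp add: power_mult_distrib mult_ac)
  finally have "\<bar>N\<bar> \<le> sqrt ((norm x * norm y * norm z * norm w)\<^sup>2 * ((2 * \<epsilon> - \<epsilon>\<^sup>2) * (2 * \<delta> - \<delta>\<^sup>2)))"
    by (metis real_sqrt_abs real_sqrt_le_iff)
  also have "\<dots> = norm x * norm z * sqrt ((2 * \<epsilon> - \<epsilon>\<^sup>2) * (2 * \<delta> - \<delta>\<^sup>2)) * (norm y * norm w)"
    by (simp add: real_sqrt_mult mult_ac)
  finally have "\<bar>N\<bar> / \<bar>y \<bullet> w\<bar>
      \<le> norm x * norm z * sqrt ((2 * \<epsilon> - \<epsilon>\<^sup>2) * (2 * \<delta> - \<delta>\<^sup>2)) * (norm y * norm w) / \<bar>y \<bullet> w\<bar>"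
    by (rule divide_right_mono) simp
  moreover have "x \<bullet> z - (x \<bullet> w) * (y \<bullet> z) / (y \<bullet> w) = N / (y \<bullet> w)"
    using assms(1) by (simp add: N_def diff_divide_distrib)
  ultimately show ?thesis
    by (simp add: abs_mult)
qed

theorem corollary2p13:
  fixes A :: "real^'m^'n"
    and U :: "real^('r::{finite,linorder})^'n"
    and \<sigma> :: "real^('r::{finite,linorder})"
    and V :: "real^('r::{finite,linorder})^'m"
    and i l :: 'n and j p :: 'm
    and \<epsilon>u \<epsilon>v :: real
  assumes "rank A = CARD('r)"
    and "thin_svd A U \<sigma> V"
    and "A $ i $ j \<noteq> 0"
    and "\<epsilon>u \<in> {0..1}" and "\<epsilon>v \<in> {0..1}"
    and "weighted_norm \<sigma> (row l U) \<noteq> 0" and "weighted_norm \<sigma> (row i U) \<noteq> 0"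
    and "weighted_norm \<sigma> (row p V) \<noteq> 0" and "weighted_norm \<sigma> (row j V) \<noteq> 0"
    and "cos (weighted_angle \<sigma> (row l U) (row i U)) \<ge> 1 - \<epsilon>u"
    and "cos (weighted_angle \<sigma> (row p V) (row j V)) \<ge> 1 - \<epsilon>v"
  shows "\<bar>cross_residual A i j $ l $ p\<bar>
           \<le> weighted_norm \<sigma> (row l U) * weighted_norm \<sigma> (row p V)
               * sqrt ((2 * \<epsilon>u - \<epsilon>u\<^sup>2) * (2 * \<epsilon>v - \<epsilon>v\<^sup>2))
             / \<bar>cos (weighted_angle \<sigma> (row i U) (row j V))\<bar>
         \<and> (\<forall>\<epsilon>. \<epsilon>u = \<epsilon> \<and> \<epsilon>v = \<epsilon> \<longrightarrow>
              \<bar>cross_residual A i j $ l $ p\<bar>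
                \<le> (2 * \<epsilon> - \<epsilon>\<^sup>2) * weighted_norm \<sigma> (row l U) * weighted_norm \<sigma> (row p V)
                  / \<bar>cos (weighted_angle \<sigma> (row i U) (row j V))\<bar>
            \<and> (2 * \<epsilon> - \<epsilon>\<^sup>2) * weighted_norm \<sigma> (row l U) * weighted_norm \<sigma> (row p V)
                  / \<bar>cos (weighted_angle \<sigma> (row i U) (row j V))\<bar>
                \<le> 2 * \<epsilon> * weighted_norm \<sigma> (row l U) * weighted_norm \<sigma> (row p V)
                  / \<bar>cos (weighted_angle \<sigma> (row i U) (row j V))\<bar>)"
proof -
  have s: "0 \<le> \<sigma> $ k" for k
    using assms(2) by (simp add: thin_svd_def less_imp_le)
  note transfer = weighted_inner_eq_inner_sqrt_scale[OF s] weighted_norm_eq_norm_sqrt_scale[OF s]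
  note entry = thin_svd_entry[OF assms(2)]
  let ?C = "\<bar>cos (weighted_angle \<sigma> (row i U) (row j V))\<bar>"
  let ?a = "weighted_norm \<sigma> (row l U)" and ?b = "weighted_norm \<sigma> (row p V)"
  have main: "\<bar>cross_residual A i j $ l $ p\<bar>
      \<le> ?a * ?b * sqrt ((2 * \<epsilon>u - \<epsilon>u\<^sup>2) * (2 * \<epsilon>v - \<epsilon>v\<^sup>2)) / ?C"
    using assms(3-11)
    unfolding cross_residual_entry entry cos_weighted_angle[OF s] transfer
    by (intro abs_minor_quotient_bound) auto
  have "0 \<le> ?a" "0 \<le> ?b"
    by (simp_all add: transfer)
  have special: "\<bar>cross_residual A i j $ l $ p\<bar> \<le> (2 * \<epsilon> - \<epsilon>\<^sup>2) * ?a * ?b / ?C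
      \<and> (2 * \<epsilon> - \<epsilon>\<^sup>2) * ?a * ?b / ?C \<le> 2 * \<epsilon> * ?a * ?b / ?C"
    if "\<epsilon>u = \<epsilon> \<and> \<epsilon>v = \<epsilon>" for \<epsilon>
  proof
    have "0 \<le> \<epsilon> * (2 - \<epsilon>)"
      using that assms(4) by auto
    then have "0 \<le> 2 * \<epsilon> - \<epsilon>\<^sup>2"
      by (simp add: algebra_simps power2_eq_square)
    then have "sqrt ((2 * \<epsilon> - \<epsilon>\<^sup>2) * (2 * \<epsilon> - \<epsilon>\<^sup>2)) = 2 * \<epsilon> - \<epsilon>\<^sup>2"
      by (metis abs_of_nonneg real_sqrt_abs2)
    then show "\<bar>cross_residual A i j $ l $ p\<bar> \<le> (2 * \<epsilon> - \<epsilon>\<^sup>2) * ?a * ?b / ?C"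
      using main that by (simp add: mult_ac)
    show "(2 * \<epsilon> - \<epsilon>\<^sup>2) * ?a * ?b / ?C \<le> 2 * \<epsilon> * ?a * ?b / ?C"
      using \<open>0 \<le> ?a\<close> \<open>0 \<le> ?b\<close> by (intro divide_right_mono mult_right_mono) auto
  qed
  show ?thesis
    using main special by blast
qed

end
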